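(* Let $(\mathcal{V},\circ,\langle\cdot,\cdot\rangle)$ be a Euclidean Jordan algebra of rank $n$ and let $\phi:\mathbb{R}\to\mathbb{R}$ be a nonnegative sublinear function. Then, for all $a,b\in\mathcal{V}$, $$\lambda\big(\phi(P_a(b))\big)\underset{w}{\prec}\lambda(a^2)*\lambda(\phi(b)).$$ In particular, $\lambda\big(|P_a(b)|\big)\underset{w}{\prec}\lambda(a^2)*\lambda(|b|)$ for all $a,b\in\mathcal{V}$.
   Context: A Euclidean Jordan algebra $(\mathcal{V},\circ,\langle\cdot,\cdot\rangle)$ is a finite-dimensional real inner product space with a commutative bilinear product $\circ$ satisfying $x\circ(x^2\circ y)=x^2\circ(x\circ y)$ and $\langle x\circ y,z\rangle=\langle y,x\circ z\rangle$ (where $x^2=x\circ x$), with unit element $e$. A Jordan frame is a set $\{e_1,\dots,e_n\}$ of primitive idempotents with $e_i\circ e_j=0$ for $i\neq j$ and $\sum_i e_i=e$; the number $n$ is the rank of $\mathcal{V}$. Every $x\in\mathcal{V}$ has a spectral decomposition $x=x_1e_1+\cdots+x_ne_n$ for some Jordan frame $\{e_1,\dots,e_n\}$, with the real numbers $x_i$ (the eigenvalues of $x$) uniquely determined up to order. $\lambda(x)\in\mathbb{R}^n$ denotes the vector of eigenvalues of $x$ in decreasing order, and $|x|:=\sum_i|x_i|e_i$. The inner product is the trace inner product $\langle x,y\rangle=\operatorname{tr}(x\circ y)$, where $\operatorname{tr}$ is the sum of eigenvalues. The quadratic representation of $a$ is $P_a(x):=2\,a\circ(a\circ x)-a^2\circ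 x$. A function $\phi:\mathbb{R}\to\mathbb{R}$ is sublinear if $\phi(\mu t)=\mu\phi(t)$ for all $\mu\geq 0$, $t\in\mathbb{R}$, and $\phi(t+s)\leq\phi(t)+\phi(s)$ for all $t,s\in\mathbb{R}$; nonnegative means $\phi(t)\ge 0$ for all $t\in\mathbb{R}$. The corresponding Löwner map, also denoted $\phi:\mathcal{V}\to\mathcal{V}$, is $\phi(x):=\sum_i\phi(x_i)e_i$ when $x=\sum_i x_ie_i$ is the spectral decomposition. For $p,q\in\mathbb{R}^n$, $p*q$ is the componentwise product and $p^\downarrow$ the decreasing rearrangement of $p$. $p\underset{w}{\prec}q$ means $\sum_{i=1}^k p_i^\downarrow\leq\sum_{i=1}^k q_i^\downarrow$ for all $1\leq k\leq n$. *)

theory Defs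
  imports "HOL-Analysis.Analysis" "HOL-Library.Multiset"
begin

section \<open>Euclidean Jordan algebras\<close>

text \<open>
  The carrier is a type of class \<open>euclidean_space\<close>, that is, a finite-dimensional (nonzero) real
  inner product space. The Jordan product \<open>J\<close> and the unit \<open>e\<close> are explicit parameters.
\<close>

locale euclidean_jordan_algebra =
  fixes J :: "'a::euclidean_space \<Rightarrow> 'a \<Rightarrow> 'a" and e :: 'a
  assumes bilinear: "bilinear J"
    and commute: "J x y = J y x"
    and jordan_identity: "J x (J (J x x) y) = J (J x x) (J x y)"
    and inner_assoc: "J x y \<bullet> z = y \<bullet> J x z"
    and unit: "J e x = x"

definition idempotent :: "('a \<Rightarrow> 'a \<Rightarrow> 'a) \<Rightarrow> 'a \<Rightarrow> bool" where
  "idempotent J c \<longleftrightarrow> J c c = c"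

definition primitive_idempotent ::
  "('a::euclidean_space \<Rightarrow> 'a \<Rightarrow> 'a) \<Rightarrow> 'a \<Rightarrow> bool" where
  "primitive_idempotent J c \<longleftrightarrow> idempotent J c \<and> c \<noteq> 0 \<and>
     \<not> (\<exists>u v. idempotent J u \<and> idempotent J v \<and> u \<noteq> 0 \<and> v \<noteq> 0 \<and> c = u + v)"

definition jordan_frame ::
  "('a::euclidean_space \<Rightarrow> 'a \<Rightarrow> 'a) \<Rightarrow> 'a \<Rightarrow> 'a set \<Rightarrow> bool" where
  "jordan_frame J e E \<longleftrightarrow> finite E \<and> (\<forall>u\<in>E. primitive_idempotent J u) \<and>
     (\<forall>u\<in>E. \<forall>v\<in>E. u \<noteq> v \<longrightarrow> J u v = 0) \<and> \<Sum>E = e"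

definition jordan_rank :: "('a::euclidean_space \<Rightarrow> 'a \<Rightarrow> 'a) \<Rightarrow> 'a \<Rightarrow> nat" where
  "jordan_rank J e = (THE n. \<exists>E. jordan_frame J e E \<and> card E = n)"

definition spectral_decomposition ::
  "('a::euclidean_space \<Rightarrow> 'a \<Rightarrow> 'a) \<Rightarrow> 'a \<Rightarrow> 'a \<Rightarrow> 'a set \<Rightarrow> ('a \<Rightarrow> real) \<Rightarrow> bool" where
  "spectral_decomposition J e x E c \<longleftrightarrow>
     jordan_frame J e E \<and> x = (\<Sum>u\<in>E. c u *\<^sub>R u)"

text \<open>
  \<open>eigenvalues J e x\<close> is the vector \<open>\<lambda>(x)\<close>: the eigenvalues of \<open>x\<close>, repeated according to
  multiplicity, in decreasing order. Vectors in \<open>\<real>\<^sup>n\<close> are lists of length \<open>n\<close>, since \<open>n\<close> is the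
  rank of the algebra rather than a type.
\<close>

definition eigenvalues ::
  "('a::euclidean_space \<Rightarrow> 'a \<Rightarrow> 'a) \<Rightarrow> 'a \<Rightarrow> 'a \<Rightarrow> real list" where
  "eigenvalues J e x = (THE xs. sorted_wrt (\<ge>) xs \<and>
     (\<exists>E c. spectral_decomposition J e x E c \<and> mset xs = image_mset c (mset_set E)))"

definition jordan_trace :: "('a::euclidean_space \<Rightarrow> 'a \<Rightarrow> 'a) \<Rightarrow> 'a \<Rightarrow> 'a \<Rightarrow> real" where
  "jordan_trace J e x = sum_list (eigenvalues J e x)"

locale trace_euclidean_jordan_algebra = euclidean_jordan_algebra +
  assumes trace_inner: "x \<bullet> y = jordan_trace J e (J x y)"

definition lowner_map ::
  "('a::euclidean_space \<Rightarrow> 'a \<Rightarrow> 'a) \<Rightarrow> 'a \<Rightarrow> (real \<Rightarrow> real) \<Rightarrow> 'a \<Rightarrow> 'a" where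
  "lowner_map J e \<phi> x = (THE y. \<exists>E c. spectral_decomposition J e x E c \<and>
     y = (\<Sum>u\<in>E. \<phi> (c u) *\<^sub>R u))"

definition jordan_abs :: "('a::euclidean_space \<Rightarrow> 'a \<Rightarrow> 'a) \<Rightarrow> 'a \<Rightarrow> 'a \<Rightarrow> 'a" where
  "jordan_abs J e x = lowner_map J e (\<lambda>t. \<bar>t\<bar>) x"

definition quadratic_rep ::
  "('a::euclidean_space \<Rightarrow> 'a \<Rightarrow> 'a) \<Rightarrow> 'a \<Rightarrow> 'a \<Rightarrow> 'a" where
  "quadratic_rep J a x = 2 *\<^sub>R J a (J a x) - J (J a a) x"

section \<open>Sublinear functions and weak majorization\<close>

definition sublinear :: "(real \<Rightarrow> real) \<Rightarrow> bool" where
  "sublinear \<phi> \<longleftrightarrow> (\<forall>\<mu>\<ge>0. \<forall>t. \<phi> (\<mu> * t) = \<mu> * \<phi> t) \<and> (\<forall>t s. \<phi> (t + s) \<le> \<phi> t + \<phi> s)"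

definition decreasing_rearrangement :: "real list \<Rightarrow> real list" where
  "decreasing_rearrangement p = rev (sort p)"

definition componentwise_product :: "real list \<Rightarrow> real list \<Rightarrow> real list" where
  "componentwise_product p q = map2 (*) p q"

text \<open>
  Weak majorization is a relation between vectors in \<open>\<real>\<^sup>n\<close>, so both lists are required to have
  length \<open>n\<close>; this also rules out truncation in \<open>take\<close>.
\<close>

definition weakly_majorized :: "nat \<Rightarrow> real list \<Rightarrow> real list \<Rightarrow> bool" where
  "weakly_majorized n p q \<longleftrightarrow> length p = n \<and> length q = n \<and>
     (\<forall>k\<in>{1..n}. sum_list (take k (decreasing_rearrangement p))
       \<le> sum_list (take k (decreasing_rearrangement q)))"

end

theory Submission
  imports Defs
begin

text \<open>
  Write \<open>P\<close> for the quadratic representation of \<open>a\<close>; it is self-adjoint, maps \<open>e\<close> to \<open>a\<^sup>2\<close>, and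
  \<open>\<langle>P p, q\<rangle> \<ge> 0\<close> for idempotents \<open>p, q\<close>. The last fact is reduced to primitive \<open>p\<close>, where a computation
  in the Peirce decomposition of \<open>a\<close> with respect to \<open>p\<close> shows that \<open>P p\<close> is a nonnegative multiple
  of an idempotent. For sums \<open>q, c\<close> of \<open>j\<close> and \<open>k\<close> elements of Jordan frames, positivity and \<open>q \<le> e\<close>
  give \<open>\<langle>P q, c\<rangle> \<le> \<langle>a\<^sup>2, c\<rangle>\<close>, and symmetrically \<open>\<langle>P q, c\<rangle> \<le> \<langle>a\<^sup>2, q\<rangle>\<close>; by Ky Fan's inequality
  \<open>\<langle>P q, c\<rangle>\<close> is at most the sum of the \<open>min j k\<close> largest eigenvalues of \<open>a\<^sup>2\<close>. Summation by parts over
  the spectral decomposition of \<open>y \<ge> 0\<close> yields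
  \<open>\<langle>P y, c\<rangle> \<le> \<Sum>\<^bsub>i \<le> k\<^esub> \<lambda>\<^sub>i(a\<^sup>2) \<lambda>\<^sub>i(y)\<close>. Finally, if \<open>u\<close> belongs to the frame of \<open>P b\<close>, its eigenvalue
  \<open>\<langle>P b, u\<rangle>\<close> is a nonnegative combination of the eigenvalues of \<open>b\<close>, so sublinearity gives
  \<open>\<phi>(\<langle>P b, u\<rangle>) \<le> \<langle>P (\<phi>(b)), u\<rangle>\<close>.
\<close>

section \<open>Peirce calculus\<close>

context euclidean_jordan_algebra
begin

lemma linear_J: "linear (J x)"
  using bilinear by (simp add: bilinear_def)

lemma J_zero [simp]: "J x 0 = 0" "J 0 x = 0"
  using bilinear_rzero[OF bilinear] bilinear_lzero[OF bilinear] by auto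

lemmas J_simps = bilinear_ladd[OF bilinear] bilinear_radd[OF bilinear]
  bilinear_lsub[OF bilinear] bilinear_rsub[OF bilinear]
  bilinear_lmul[OF bilinear] bilinear_rmul[OF bilinear]
  bilinear_lneg[OF bilinear] bilinear_rneg[OF bilinear]

lemma J_sum_right: "J x (\<Sum>i\<in>A. f i) = (\<Sum>i\<in>A. J x (f i))"
  by (rule linear_sum[OF linear_J])

lemma J_sum_left: "J (\<Sum>i\<in>A. f i) x = (\<Sum>i\<in>A. J (f i) x)"
  using J_sum_right[of x f A] by (simp add: commute)

lemma unit_right [simp]: "J x e = x"
  using unit commute by metis

text \<open>Polarization of the cubic Jordan identity: the difference of its instances at
  \<open>x + y\<close> and \<open>x - y\<close> keeps only the terms odd in \<open>y\<close>, and
  the instance at \<open>y\<close> removes the cubic one.\<close>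

lemma jordan_identity_linearized:
  "2 *\<^sub>R J x (J (J x y) w) + J y (J (J x x) w) = 2 *\<^sub>R J (J x y) (J x w) + J (J x x) (J y w)"
proof (subst vector_eq_rdot[symmetric], rule allI)
  fix z
  show "(2 *\<^sub>R J x (J (J x y) w) + J y (J (J x x) w)) \<bullet> z
      = (2 *\<^sub>R J (J x y) (J x w) + J (J x x) (J y w)) \<bullet> z"
    using arg_cong[OF jordan_identity[of "x + y" w], of "\<lambda>v. v \<bullet> z"]
      arg_cong[OF jordan_identity[of "x - y" w], of "\<lambda>v. v \<bullet> z"]
      arg_cong[OF jordan_identity[of y w], of "\<lambda>v. v \<bullet> z"]
    by (simp add: J_simps inner_simps commute[of y x])
qed

lemma jordan_identity_fully_linearized:
  "J x (J (J y z) w) + J y (J (J x z) w) + J z (J (J x y) w)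
   = J (J y z) (J x w) + J (J x z) (J y w) + J (J x y) (J z w)"
proof (subst vector_eq_rdot[symmetric], rule allI)
  fix v
  show "(J x (J (J y z) w) + J y (J (J x z) w) + J z (J (J x y) w)) \<bullet> v
      = (J (J y z) (J x w) + J (J x z) (J y w) + J (J x y) (J z w)) \<bullet> v"
    using arg_cong[OF jordan_identity_linearized[of "x + z" y w], of "\<lambda>u. u \<bullet> v"]
      arg_cong[OF jordan_identity_linearized[of x y w], of "\<lambda>u. u \<bullet> v"]
      arg_cong[OF jordan_identity_linearized[of z y w], of "\<lambda>u. u \<bullet> v"]
    by (simp add: J_simps inner_simps commute[of z y] commute[of z x])
qed

text \<open>The right-hand side of the previous identity is symmetric in all four variables.\<close>

lemma J_triple_operator:
  "J (J x (J y z)) w = J x (J (J y z) w) + J y (J (J x z) w) + J z (J (J x y) w)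
     - J y (J x (J z w)) - J z (J x (J y w))"
  using jordan_identity_fully_linearized[of x y z w] jordan_identity_fully_linearized[of w y z x]
  by (simp add: commute algebra_simps)

text \<open>Elements of the Peirce spaces 1 and 0 of \<open>c\<close> operator-commute with
  \<open>c\<close>, because the linearized identity collapses for them.\<close>

lemma J_commute_idempotent:
  assumes c: "J c c = c" and y: "J c y = y \<or> J c y = 0"
  shows "J c (J y z) = J y (J c z)"
  using y jordan_identity_linearized[of c y z] by (auto simp: c scaleR_2)

text \<open>The product is an eigenvector of \<open>J c\<close> for both 0 and 1.\<close>

lemma Peirce_0_1:
  assumes "J c c = c" "J c y = y" "J c z = 0"
  shows "J y z = 0"
proof -
  have "J c (J y z) = 0" "J c (J z y) = J z y"
    using J_commute_idempotent[of c y z] J_commute_idempotent[of c z y] assms by simp_all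
  then show ?thesis by (simp add: commute)
qed

text \<open>The square of an element of the Peirce 1/2-space has no 1/2-component, so applying
  \<open>J c\<close> leaves only its 1-component.\<close>

lemma Peirce_half_half:
  assumes c: "J c c = c" and v: "J c v = (1/2) *\<^sub>R v"
  shows "J c (J c (J v v)) = J c (J v v)"
  using jordan_identity_linearized[of v c c] v c by (simp add: J_simps commute)

text \<open>The operator \<open>J c\<close> is annihilated by t (2 t - 1) (t - 1), which confines
  its eigenvalues to 0, 1/2 and 1.\<close>

lemma Peirce_polynomial:
  assumes c: "J c c = c"
  shows "2 *\<^sub>R J c (J c (J c x)) - 3 *\<^sub>R J c (J c x) + J c x = 0"
proof -
  have "3 *\<^sub>R v = v + v + v" for v :: 'a
    using scaleR_left_distrib[of 2 1 v] by (simp add: scaleR_2)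
  then show ?thesis
    using J_triple_operator[of c c c x] c by (simp add: scaleR_2 algebra_simps)
qed

end

section \<open>Spectral decomposition\<close>

text \<open>A maximizer of the quadratic form on the compact unit sphere of \<open>S\<close> is an
  eigenvector.\<close>

lemma selfadjoint_eigenvector:
  fixes f :: "'a::euclidean_space \<Rightarrow> 'a"
  assumes f: "linear f" and sa: "\<And>x y. f x \<bullet> y = x \<bullet> f y"
    and S: "subspace S" and inv: "\<And>x. x \<in> S \<Longrightarrow> f x \<in> S" and nz: "S \<noteq> {0}"
  obtains u t where "u \<in> S" "norm u = 1" "f u = t *\<^sub>R u"
proof -
  let ?K = "S \<inter> sphere 0 1"
  obtain z where z: "z \<in> S" "z \<noteq> 0" using nz subspace_0[OF S] by auto
  have "z /\<^sub>R norm z \<in> ?K" using z S by (simp add: subspace_scale)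
  moreover have "compact ?K"
    using closed_subspace[OF S] by (simp add: closed_Int_compact)
  moreover have cont: "continuous_on ?K (\<lambda>x. f x \<bullet> x)"
    using f by (intro continuous_intros linear_continuous_on) (simp add: linear_conv_bounded_linear)
  ultimately obtain u where u: "u \<in> ?K" "\<And>x. x \<in> ?K \<Longrightarrow> f x \<bullet> x \<le> f u \<bullet> u"
    using continuous_attains_sup[of ?K "\<lambda>x. f x \<bullet> x"] by blast
  define t where "t = f u \<bullet> u"
  have le: "f x \<bullet> x \<le> t * (x \<bullet> x)" if "x \<in> S" for x
  proof (cases "x = 0")
    case True then show ?thesis using linear_0[OF f] by simp
  next
    case False
    have "x /\<^sub>R norm x \<in> ?K" using that False S by (simp add: subspace_scale)
    then have "f (x /\<^sub>R norm x) \<bullet> (x /\<^sub>R norm x) \<le> t" unfolding t_def by (rule u(2))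
    then show ?thesis
      using False by (simp add: linear_scale[OF f] field_simps flip: power2_norm_eq_inner)
        (simp add: power2_eq_square)
  qed
  text \<open>First-order optimality of \<open>u\<close>: the defect \<open>f u - t u\<close> lies in \<open>S\<close>, and the quadratic form
    would increase in its direction if it were nonzero.\<close>
  have "f u - t *\<^sub>R u = 0"
  proof (rule ccontr)
    define v where "v = f u - t *\<^sub>R u"
    assume "f u - t *\<^sub>R u \<noteq> 0"
    then have v0: "v \<bullet> v > 0" by (simp add: v_def)
    have uS: "u \<in> S" "u \<bullet> u = 1" using u by (auto simp: norm_eq_1)
    have vS: "v \<in> S" using uS inv S by (simp add: v_def subspace_diff subspace_scale)
    have *: "2 * s * (v \<bullet> v) \<le> s\<^sup>2 * (t * (v \<bullet> v) - f v \<bullet> v)" for s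
    proof -
      have "u + s *\<^sub>R v \<in> S" using uS vS S by (simp add: subspace_add subspace_scale)
      from le[OF this] have "f u \<bullet> u + 2 * s * (f u \<bullet> v) + s\<^sup>2 * (f v \<bullet> v)
          \<le> t * (1 + 2 * s * (u \<bullet> v) + s\<^sup>2 * (v \<bullet> v))"
        using sa[of v u] uS
        by (simp add: linear_add[OF f] linear_scale[OF f] inner_simps inner_commute power2_eq_square algebra_simps)
      moreover have "f u \<bullet> v = v \<bullet> v + t * (u \<bullet> v)"
        using inner_diff_left[of "f u" "t *\<^sub>R u" v] by (simp flip: v_def)
      ultimately show ?thesis using t_def by (simp add: algebra_simps)
    qed
    \<comment> \<open>\<open>C\<close> is positive and dominates the coefficient of s^2, so the step
      s = (v, v) / C makes the linear term win.\<close>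
    define C where "C = \<bar>t * (v \<bullet> v) - f v \<bullet> v\<bar> + v \<bullet> v"
    have C: "C > 0" using v0 by (simp add: C_def add_nonneg_pos)
    have "2 * (v \<bullet> v / C) * (v \<bullet> v) \<le> (v \<bullet> v / C)\<^sup>2 * (t * (v \<bullet> v) - f v \<bullet> v)"
      by (rule *)
    also have "\<dots> \<le> (v \<bullet> v / C)\<^sup>2 * C"
      using v0 unfolding C_def by (intro mult_left_mono) (linarith, simp)
    finally have "2 * (v \<bullet> v / C) * (v \<bullet> v) \<le> (v \<bullet> v / C)\<^sup>2 * C" .
    then have "2 * (v \<bullet> v)\<^sup>2 \<le> (v \<bullet> v)\<^sup>2" using C by (simp add: field_simps power2_eq_square)
    then show False using v0 by simp
  qed
  then show ?thesis using that[of u t] u by simp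
qed

text \<open>Induction on the dimension, splitting off a unit eigenvector and passing to its
  orthogonal complement in \<open>S\<close>. The summands are indexed by their eigenvalues, so
  distinct indices mean distinct eigenvalues.\<close>

lemma selfadjoint_decomposition:
  fixes f :: "'a::euclidean_space \<Rightarrow> 'a"
  assumes f: "linear f" and sa: "\<And>x y. f x \<bullet> y = x \<bullet> f y"
    and S: "subspace S" and inv: "\<And>x. x \<in> S \<Longrightarrow> f x \<in> S" and "x \<in> S"
  shows "\<exists>T w. finite T \<and> x = (\<Sum>t\<in>T. w t) \<and> (\<forall>t\<in>T. w t \<in> S \<and> f (w t) = t *\<^sub>R w t)"
  using S inv \<open>x \<in> S\<close>
proof (induction "dim S" arbitrary: S x rule: less_induct)
  case less
  show ?case
  proof (cases "S = {0}")
    case True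
    then show ?thesis using less.prems by (intro exI[of _ "{}"]) auto
  next
    case False
    obtain u s where u: "u \<in> S" "norm u = 1" "f u = s *\<^sub>R u"
      using selfadjoint_eigenvector[OF f sa] less.prems False by metis
    define S' where "S' = S \<inter> {y. y \<bullet> u = 0}"
    have S': "subspace S'"
      unfolding S'_def using less.prems(1)
      by (intro subspace_inter) (auto simp: subspace_def inner_simps)
    have "u \<notin> S'" using u by (auto simp: S'_def)
    moreover have "S' \<subseteq> S" by (auto simp: S'_def)
    ultimately have "span S' \<subset> span S"
      using u(1) S' less.prems(1) by (metis psubsetI span_eq_iff)
    then have dim: "dim S' < dim S" by (rule dim_psubset)
    have inv': "f y \<in> S'" if "y \<in> S'" for y
      using that less.prems(2) sa[of y u] u by (auto simp: S'_def)
    define y where "y = x - (x \<bullet> u) *\<^sub>R u"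
    have "y \<in> S'" using less.prems u
      by (auto simp: y_def S'_def inner_simps subspace_diff subspace_scale norm_eq_1)
    from less.hyps[OF dim S' inv' this]
    obtain T w where T: "finite T" "y = (\<Sum>t\<in>T. w t)" "\<forall>t\<in>T. w t \<in> S' \<and> f (w t) = t *\<^sub>R w t"
      by blast
    \<comment> \<open>The eigenvalue \<open>s\<close> may or may not occur in \<open>T\<close>;
      extending \<open>w\<close> by 0 and adding the new component at \<open>s\<close> treats both
      cases at once.\<close>
    define w' where "w' = (\<lambda>t. if t \<in> T then w t else 0)"
    define w2 where "w2 = (\<lambda>t. w' t + (if t = s then (x \<bullet> u) *\<^sub>R u else 0))"
    have "(\<Sum>t\<in>insert s T. w2 t) = (\<Sum>t\<in>insert s T. w' t) + (x \<bullet> u) *\<^sub>R u"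
      using T by (simp add: w2_def sum.distrib)
    also have "(\<Sum>t\<in>insert s T. w' t) = (\<Sum>t\<in>T. w t)"
      using T(1) by (intro sum.mono_neutral_cong_right) (auto simp: w'_def)
    finally have "x = (\<Sum>t\<in>insert s T. w2 t)" using T(2) by (simp add: y_def algebra_simps)
    moreover have "w2 t \<in> S \<and> f (w2 t) = t *\<^sub>R w2 t" if "t \<in> insert s T" for t
      using T(3) u less.prems that
      by (auto simp: w2_def w'_def S'_def linear_add[OF f] linear_scale[OF f] linear_0[OF f] subspace_0
          algebra_simps intro!: subspace_add subspace_scale)
    ultimately show ?thesis using T(1) by (intro exI[of _ "insert s T"] exI[of _ w2]) auto
  qed
qed

context euclidean_jordan_algebra
begin

text \<open>On the spectrum \<open>{0, 1/2, 1}\<close> of multiplication by an idempotent,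
  \<open>t = t\<^sup>2 + 4 (t - t\<^sup>2)\<^sup>2\<close>.\<close>

lemma inner_J_idempotent:
  assumes c: "J c c = c"
  shows "J c x \<bullet> x = (norm (J c x))\<^sup>2 + 4 * (norm (J c x - J c (J c x)))\<^sup>2"
proof -
  have *: "J c y \<bullet> z = y \<bullet> J c z" for y z using inner_assoc by simp
  have "(2 *\<^sub>R J c (J c (J c x)) - 3 *\<^sub>R J c (J c x) + J c x) \<bullet> J c x = 0"
    "(2 *\<^sub>R J c (J c (J c x)) - 3 *\<^sub>R J c (J c x) + J c x) \<bullet> x = 0"
    using Peirce_polynomial[OF c] by simp_all
  then show ?thesis
    unfolding power2_norm_eq_inner by (simp add: inner_simps * inner_commute)
qed

text \<open>Since \<open>d\<close> is its own square, the inner product is the quadratic form of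
  \<open>J c\<close> at \<open>d\<close>, a sum of squares.\<close>

lemma idempotents_inner_nonneg:
  assumes "J c c = c" "J d d = d"
  shows "c \<bullet> d \<ge> 0"
proof -
  have "c \<bullet> d = J c d \<bullet> d" using inner_assoc[of d c d] assms by (simp add: commute inner_commute)
  then show ?thesis using inner_J_idempotent[OF assms(1), of d] by simp
qed

lemma idempotents_orthogonal:
  assumes "J c c = c" "J d d = d" "c \<bullet> d = 0"
  shows "J c d = 0"
proof -
  have "J c d \<bullet> d = 0" using inner_assoc[of d c d] assms by (simp add: commute inner_commute)
  then show ?thesis using inner_J_idempotent[OF assms(1), of d]
    by (smt (verit) norm_eq_zero zero_le_power2 power_eq_0_iff)
qed

text \<open>The iterates are the powers of \<open>x\<close> with \<open>p\<close> as unit.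
  \<open>J_triple_operator\<close> expresses multiplication by one power through the two preceding
  ones and \<open>J x\<close>, \<open>J (J x x)\<close>, whence an induction over pairs.\<close>

lemma J_funpow_commute:
  assumes p: "J p p = p" and px: "J p x = x"
  shows "J x (J ((J x ^^ n) p) w) = J ((J x ^^ n) p) (J x w)"
proof -
  define q where "q n = (J x ^^ n) p" for n
  have q: "q 0 = p" "q (Suc n) = J x (q n)" for n by (simp_all add: q_def)
  have q1: "q 1 = x" using px by (simp add: q commute)
  have "(\<forall>w. J x (J (q n) w) = J (q n) (J x w)) \<and> (\<forall>w. J x (J (q (Suc n)) w) = J (q (Suc n)) (J x w))"
  proof (induction n)
    case 0
    show ?case using J_commute_idempotent[OF p, of x] px q1 q(1) by (simp)
  next
    case (Suc n)
    have "J (q (Suc (Suc n))) w = J x (J (q (Suc n)) w) + J x (J (q (Suc n)) w) + J (q n) (J (J x x) w)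
     - J x (J x (J (q n) w)) - J (q n) (J x (J x w))" for w
      using J_triple_operator[of x x "q n" w] by (simp add: q)
    then show ?case using Suc jordan_identity by (simp add: J_simps)
  qed
  then show ?thesis by (simp add: q_def)
qed

text \<open>On the span \<open>S\<close> of the powers of \<open>x\<close>, the unit
  \<open>p\<close> itself is split into eigenvectors of \<open>J x\<close>. Components with
  different eigenvalues annihilate each other, and multiplying a component by \<open>p\<close> then
  shows that it is idempotent.\<close>

lemma spectral_idempotents:
  assumes p: "J p p = p" and px: "J p x = x"
  obtains T w where "finite T" "p = (\<Sum>t\<in>T. w t)" "x = (\<Sum>t\<in>T. t *\<^sub>R w t)"
    "\<And>t. t \<in> T \<Longrightarrow> J (w t) (w t) = w t"
    "\<And>s t. s \<in> T \<Longrightarrow> t \<in> T \<Longrightarrow> s \<noteq> t \<Longrightarrow> J (w s) (w t) = 0"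
proof -
  define S where "S = span (range (\<lambda>n. (J x ^^ n) p))"
  have comm: "J x (J y z) = J y (J x z)" if "y \<in> S" for y z
    using that unfolding S_def
    by (induction rule: span_induct)
      (auto simp: subspace_def J_simps J_funpow_commute[OF p px])
  have pS: "p \<in> S" unfolding S_def by (rule span_base) (auto intro!: image_eqI[of _ _ 0])
  have inv: "J x y \<in> S" if "y \<in> S" for y
    using that unfolding S_def
  proof (induction rule: span_induct)
    case base
    then show ?case by (auto simp: subspace_def J_simps span_add span_scale span_0)
  next
    case (step y)
    then obtain n where "y = (J x ^^ n) p" by auto
    then have "J x y = (J x ^^ (Suc n)) p" by simp
    then show ?case by (metis rangeI span_base)
  qed
  have unit: "J p y = y" if "y \<in> S" for y
    using that unfolding S_def
  proof (induction rule: span_induct)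
    case base
    then show ?case by (auto simp: subspace_def J_simps)
  next
    case (step y)
    then obtain n where n: "y = (J x ^^ n) p" by auto
    have "J p ((J x ^^ n) p) = (J x ^^ n) p"
      using J_commute_idempotent[OF p, of x] px p by (induction n) auto
    then show ?case using n by simp
  qed
  obtain T w where T: "finite T" "p = (\<Sum>t\<in>T. w t)"
    and w: "\<forall>t\<in>T. w t \<in> S \<and> J x (w t) = t *\<^sub>R w t"
    using selfadjoint_decomposition[OF linear_J _ _ inv pS] inner_assoc S_def subspace_span by metis
  have orth: "J (w s) (w t) = 0" if "s \<in> T" "t \<in> T" "s \<noteq> t" for s t
  proof -
    have "t *\<^sub>R J (w s) (w t) = s *\<^sub>R J (w s) (w t)"
      using comm[of "w s" "w t"] comm[of "w t" "w s"] w that by (simp add: J_simps commute[of "w t"])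
    then show ?thesis using that by simp
  qed
  have "J (w t) (w t) = w t" if "t \<in> T" for t
  proof -
    have "w t = J p (w t)" using unit w that by simp
    also have "\<dots> = (\<Sum>s\<in>T. J (w s) (w t))" by (simp add: T(2) J_sum_left)
    also have "\<dots> = (\<Sum>s\<in>{t}. J (w s) (w t))"
      using T(1) that orth by (intro sum.mono_neutral_right) auto
    finally show ?thesis by simp
  qed
  moreover have "x = (\<Sum>t\<in>T. t *\<^sub>R w t)"
  proof -
    have "x = J x p" using px commute by simp
    then show ?thesis using w by (simp add: T(2) J_sum_right)
  qed
  ultimately show ?thesis using T orth that by blast
qed

section \<open>Primitive idempotents and Jordan frames\<close>

lemma primitive_idempotentD:
  assumes "primitive_idempotent J p"
  shows "J p p = p" "p \<noteq> 0"
  using assms by (auto simp: primitive_idempotent_def idempotent_def)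

lemma primitive_idempotent_splitD:
  assumes "primitive_idempotent J p" "J u u = u" "J (p - u) (p - u) = p - u" "u \<noteq> 0"
  shows "p = u"
proof (rule ccontr)
  assume "p \<noteq> u"
  then have "p = u + (p - u)" "p - u \<noteq> 0" by simp_all
  then show False using assms unfolding primitive_idempotent_def idempotent_def by blast
qed

lemma J_idempotent_diff:
  assumes "J p p = p" "J u u = u" "J p u = u"
  shows "J (p - u) (p - u) = p - u"
  using assms by (simp add: J_simps commute)

text \<open>A nonzero spectral idempotent of \<open>x\<close> lies below \<open>p\<close>, so by
  primitivity it equals \<open>p\<close>.\<close>

lemma primitive_Peirce_1:
  assumes p: "primitive_idempotent J p" and px: "J p x = x"
  shows "\<exists>t. x = t *\<^sub>R p"
proof -
  note pp = primitive_idempotentD[OF p]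
  obtain T w where T: "finite T" "p = (\<Sum>t\<in>T. w t)" "x = (\<Sum>t\<in>T. t *\<^sub>R w t)"
    "\<And>t. t \<in> T \<Longrightarrow> J (w t) (w t) = w t"
    "\<And>s t. s \<in> T \<Longrightarrow> t \<in> T \<Longrightarrow> s \<noteq> t \<Longrightarrow> J (w s) (w t) = 0"
    by (rule spectral_idempotents[OF pp(1) px]) blast
  obtain t where t: "t \<in> T" "w t \<noteq> 0" using T(2) pp(2) by (metis sum.neutral)
  have wf: "J (w t) (\<Sum>s\<in>T. f s *\<^sub>R w s) = f t *\<^sub>R w t" for f :: "real \<Rightarrow> real"
  proof -
    have "J (w t) (\<Sum>s\<in>T. f s *\<^sub>R w s) = (\<Sum>s\<in>{t}. f s *\<^sub>R J (w t) (w s))"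
      unfolding J_sum_right J_simps using T t by (intro sum.mono_neutral_right) auto
    then show ?thesis using T t by simp
  qed
  have "J p (w t) = w t" using wf[of "\<lambda>_. 1"] T(2) by (simp add: commute)
  then have "p = w t"
    using primitive_idempotent_splitD[OF p] J_idempotent_diff pp T(4) t by metis
  then have "x = t *\<^sub>R p" using wf[of "\<lambda>s. s"] px T(3) by simp
  then show ?thesis by blast
qed

lemma Peirce_1_orthogonal:
  assumes "J p p = p" "J q q = q" "J p q = 0" "J p x = x" "J q y = y"
  shows "J x y = 0"
proof -
  have "J x q = 0" using Peirce_0_1 assms by blast
  then have "J y x = 0" using Peirce_0_1 assms commute by metis
  then show ?thesis by (simp add: commute)
qed

text \<open>Frames are considered for any idempotent \<open>p\<close> in place of the unit, so that
  frames of orthogonal idempotents can be glued.\<close>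

lemma jordan_frameD:
  assumes "jordan_frame J p E"
  shows "finite E" "\<Sum>E = p" "u \<in> E \<Longrightarrow> primitive_idempotent J u" "u \<in> E \<Longrightarrow> J u u = u"
    "u \<in> E \<Longrightarrow> u \<noteq> 0" "u \<in> E \<Longrightarrow> v \<in> E \<Longrightarrow> u \<noteq> v \<Longrightarrow> J u v = 0"
  using assms primitive_idempotentD unfolding jordan_frame_def by blast+

lemma J_frame_sum:
  assumes E: "jordan_frame J p E" and "u \<in> E" "A \<subseteq> E"
  shows "J u (\<Sum>v\<in>A. c v *\<^sub>R v) = (if u \<in> A then c u *\<^sub>R u else 0)"
proof -
  have fin: "finite A" using assms jordan_frameD(1) finite_subset by blast
  have "J u (\<Sum>v\<in>A. c v *\<^sub>R v) = (\<Sum>v\<in>A. if v = u then c u *\<^sub>R u else 0)"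
    unfolding J_sum_right J_simps
    using assms jordan_frameD(4,6)[OF E] by (intro sum.cong) auto
  then show ?thesis using fin by simp
qed

lemma J_frame_subset_sum:
  assumes E: "jordan_frame J p E" and "u \<in> E" "A \<subseteq> E"
  shows "J u (\<Sum>A) = (if u \<in> A then u else 0)"
  using J_frame_sum[OF assms, of "\<lambda>_. 1"] by simp

lemma frame_subset_sum_idempotent:
  assumes E: "jordan_frame J p E" and "A \<subseteq> E"
  shows "J (\<Sum>A) (\<Sum>A) = \<Sum>A"
  unfolding J_sum_left
  using assms J_frame_subset_sum[OF E] by (intro sum.cong) (simp_all add: subset_iff)

text \<open>Each \<open>F t\<close> lies in the Peirce 1-space of \<open>w t\<close>, and these
  spaces annihilate each other. An element common to two of the frames would have square 0.\<close>

lemma jordan_frame_UNION: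
  assumes "finite T" "\<And>t. t \<in> T \<Longrightarrow> J (w t) (w t) = w t"
    and orth: "\<And>s t. s \<in> T \<Longrightarrow> t \<in> T \<Longrightarrow> s \<noteq> t \<Longrightarrow> J (w s) (w t) = 0"
    and F: "\<And>t. t \<in> T \<Longrightarrow> jordan_frame J (w t) (F t)"
  shows "jordan_frame J (\<Sum>t\<in>T. w t) (\<Union>t\<in>T. F t)"
    and "s \<in> T \<Longrightarrow> t \<in> T \<Longrightarrow> s \<noteq> t \<Longrightarrow> F s \<inter> F t = {}"
proof -
  have "J u v = 0" if "s \<in> T" "t \<in> T" "s \<noteq> t" "u \<in> F s" "v \<in> F t" for s t u v
  proof -
    have "J (w s) u = u" "J (w t) v = v"
      using J_frame_subset_sum[OF F] jordan_frameD(2)[OF F] that by (metis commute order_refl)+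
    then show ?thesis using Peirce_1_orthogonal assms(2) orth that by blast
  qed
  note * = this
  show disj: "F s \<inter> F t = {}" if "s \<in> T" "t \<in> T" "s \<noteq> t" for s t
    using *[OF that] jordan_frameD(4,5)[OF F] that by fastforce
  have "\<Sum>(\<Union>t\<in>T. F t) = (\<Sum>t\<in>T. \<Sum>(F t))"
    using assms(1) jordan_frameD(1)[OF F] disj by (intro sum.UNION_disjoint) auto
  also have "\<dots> = (\<Sum>t\<in>T. w t)" using jordan_frameD(2)[OF F] by simp
  finally show "jordan_frame J (\<Sum>t\<in>T. w t) (\<Union>t\<in>T. F t)"
    using assms(1) F * unfolding jordan_frame_def by (auto; blast)
qed

text \<open>Induction on the dimension of the Peirce 1-space: in a splitting p = u + v, the space of
  \<open>u\<close> is strictly smaller because it misses \<open>v\<close>, and vice versa.\<close>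

lemma jordan_frame_exists:
  assumes "J p p = p"
  shows "\<exists>E. jordan_frame J p E"
  using assms
proof (induction "dim {y. J p y = y}" arbitrary: p rule: less_induct)
  case less
  consider "p = 0" | "primitive_idempotent J p" |
    u v where "J u u = u" "J v v = v" "u \<noteq> 0" "v \<noteq> 0" "p = u + v"
    using less.prems unfolding primitive_idempotent_def idempotent_def by blast
  then show ?case
  proof cases
    case 1
    then show ?thesis by (intro exI[of _ "{}"]) (simp add: jordan_frame_def)
  next
    case 2
    then show ?thesis by (intro exI[of _ "{p}"]) (simp add: jordan_frame_def)
  next
    case 3
    have "2 *\<^sub>R J u v = 0" using less.prems 3 by (simp add: J_simps commute scaleR_2)
    then have uv: "J u v = 0" by simp
    have smaller: "dim {y. J a y = y} < dim {y. J p y = y}"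
      if "J a a = a" "J b b = b" "J a b = 0" "b \<noteq> 0" "p = a + b" for a b
    proof -
      have sub: "subspace {y. J c y = y}" for c by (auto simp: subspace_def J_simps)
      have "J p y = y" if "J a y = y" for y
        using Peirce_0_1[of a y b] that \<open>J a a = a\<close> \<open>J a b = 0\<close> \<open>p = a + b\<close>
        by (simp add: J_simps commute)
      moreover have "J p b = b" "J a b \<noteq> b" using that by (simp_all add: J_simps)
      ultimately have "{y. J a y = y} \<subset> {y. J p y = y}" by blast
      then show ?thesis by (intro dim_psubset) (simp add: span_eq_iff[THEN iffD2] sub)
    qed
    obtain E F where E: "jordan_frame J u E" and F: "jordan_frame J v F"
      using less.hyps[OF smaller[of u v]] less.hyps[OF smaller[of v u]] 3 uv
      by (metis add.commute commute)
    \<comment> \<open>The type \<open>bool\<close> serves as a two-element index set for gluing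
      \<open>E\<close> and \<open>F\<close>.\<close>
    have "jordan_frame J (\<Sum>t\<in>UNIV. if t then u else v) (\<Union>t\<in>UNIV. if t then E else F)"
      using 3 uv E F by (intro jordan_frame_UNION) (auto simp: commute)
    then show ?thesis using 3 by (auto simp: UNIV_bool add.commute)
  qed
qed

lemma spectral_decomposition_exists: "\<exists>E c. spectral_decomposition J e x E c"
proof -
  obtain T w where T: "finite T" "e = (\<Sum>t\<in>T. w t)" "x = (\<Sum>t\<in>T. t *\<^sub>R w t)"
    "\<And>t. t \<in> T \<Longrightarrow> J (w t) (w t) = w t"
    "\<And>s t. s \<in> T \<Longrightarrow> t \<in> T \<Longrightarrow> s \<noteq> t \<Longrightarrow> J (w s) (w t) = 0"
    by (rule spectral_idempotents[OF unit[of e] unit[of x]]) blast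
  have "\<forall>t\<in>T. \<exists>E. jordan_frame J (w t) E" using jordan_frame_exists T(4) by blast
  then obtain F where F: "\<And>t. t \<in> T \<Longrightarrow> jordan_frame J (w t) (F t)" by (metis bchoice)
  note U = jordan_frame_UNION[of T w F, OF T(1,4,5) F]
  define c where "c u = (THE t. t \<in> T \<and> u \<in> F t)" for u
  have c: "c u = t" if "t \<in> T" "u \<in> F t" for t u
    unfolding c_def using that U(2) by (intro the_equality) auto
  have "(\<Sum>u\<in>(\<Union>t\<in>T. F t). c u *\<^sub>R u) = (\<Sum>t\<in>T. \<Sum>u\<in>F t. c u *\<^sub>R u)"
    using T(1) jordan_frameD(1)[OF F] U(2) by (intro sum.UNION_disjoint) auto
  also have "\<dots> = (\<Sum>t\<in>T. t *\<^sub>R \<Sum>(F t))"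
    unfolding scaleR_sum_right using c by (intro sum.cong) auto
  also have "\<dots> = x" using jordan_frameD(2)[OF F] T(3) by simp
  finally show ?thesis
    using U(1) T(2) unfolding spectral_decomposition_def by metis
qed

section \<open>Independence of the chosen spectral decomposition\<close>

lemma spectral_decompositionD:
  assumes "spectral_decomposition J e x E c"
  shows "jordan_frame J e E" "x = (\<Sum>u\<in>E. c u *\<^sub>R u)" "u \<in> E \<Longrightarrow> J x u = c u *\<^sub>R u"
  using assms J_frame_sum[of e E u E c] unfolding spectral_decomposition_def
  by (auto simp: commute)

text \<open>Eigenvectors of the self-adjoint \<open>J x\<close> for different eigenvalues are
  orthogonal, also across two frames. Hence each of the two projections absorbs the other.\<close>

lemma eigenprojection_unique:
  assumes E: "spectral_decomposition J e x E c" and F: "spectral_decomposition J e x F d"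
  shows "\<Sum>{u \<in> E. c u = t} = \<Sum>{v \<in> F. d v = t}"
proof -
  have orth: "J u v = 0"
    if E: "spectral_decomposition J e x E c" and F: "spectral_decomposition J e x F d"
      and "u \<in> E" "v \<in> F" "c u \<noteq> d v" for E F c d u v
  proof -
    have "c u * (u \<bullet> v) = d v * (u \<bullet> v)"
      using inner_assoc[of x u v] spectral_decompositionD(3)[OF E] spectral_decompositionD(3)[OF F] that
      by simp
    then have "u \<bullet> v = 0" using that by simp
    then show ?thesis
      using idempotents_orthogonal jordan_frameD(4) spectral_decompositionD(1) that by metis
  qed
  have *: "J (\<Sum>{u \<in> E. c u = t}) (\<Sum>{v \<in> F. d v = t}) = \<Sum>{u \<in> E. c u = t}"
    if E: "spectral_decomposition J e x E c" and F: "spectral_decomposition J e x F d" for E F c d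
  proof -
    have "J u (\<Sum>{v \<in> F. d v = t}) = u" if u: "u \<in> E" "c u = t" for u
    proof -
      have fin: "finite F" using spectral_decompositionD(1)[OF F] jordan_frameD(1) by blast
      have "u = J u (\<Sum>F)"
        using jordan_frameD(2)[OF spectral_decompositionD(1)[OF F]] by simp
      also have "\<dots> = J u (\<Sum>{v \<in> F. d v = t})"
        unfolding J_sum_right using fin orth[OF E F u(1)] u(2)
        by (intro sum.mono_neutral_right) fastforce+
      finally show ?thesis by simp
    qed
    then show ?thesis unfolding J_sum_left by simp
  qed
  show ?thesis using *[OF E F] *[OF F E] by (metis commute)
qed

text \<open>Grouping by eigenvalues expresses the sum through eigenprojections alone, so the
  description in \<open>lowner_map\<close> is well defined.\<close>

lemma lowner_map_eq:
  assumes E: "spectral_decomposition J e x E c"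
  shows "lowner_map J e \<phi> x = (\<Sum>u\<in>E. \<phi> (c u) *\<^sub>R u)"
proof -
  have *: "(\<Sum>u\<in>E. \<phi> (c u) *\<^sub>R u) = (\<Sum>t\<in>T. \<phi> t *\<^sub>R \<Sum>{u \<in> E. c u = t})"
    if "spectral_decomposition J e x E c" "finite T" "c ` E \<subseteq> T" for E c T
  proof -
    have "finite E" using spectral_decompositionD(1) jordan_frameD(1) that by blast
    from sum.group[OF this that(2,3), of "\<lambda>u. \<phi> (c u) *\<^sub>R u"] show ?thesis
      by (simp add: scaleR_sum_right)
  qed
  have "(\<Sum>u\<in>F. \<phi> (d u) *\<^sub>R u) = (\<Sum>u\<in>E. \<phi> (c u) *\<^sub>R u)"
    if F: "spectral_decomposition J e x F d" for F d
  proof -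
    have "finite (c ` E \<union> d ` F)"
      using spectral_decompositionD(1) jordan_frameD(1) E F by blast
    then show ?thesis
      using *[OF E, of "c ` E \<union> d ` F"] *[OF F, of "c ` E \<union> d ` F"] eigenprojection_unique[OF E F] by simp
  qed
  then show ?thesis unfolding lowner_map_def using E by (intro the_equality) blast+
qed

end

section \<open>Trace and eigenvalues\<close>

context euclidean_jordan_algebra
begin

text \<open>If the coefficients on a frame are pairwise distinct, the eigenprojections are primitive, so the
  decomposition is unique and the description operator in the definition of the eigenvalues is
  under control without knowing yet that all frames have the same size.\<close>

lemma spectral_decomposition_unique_inj:
  assumes E: "spectral_decomposition J e x E c" and F: "spectral_decomposition J e x F d"
    and inj: "inj_on c E"
  shows "F = E" "u \<in> E \<Longrightarrow> d u = c u"
proof -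
  note frE = spectral_decompositionD(1)[OF E] and frF = spectral_decompositionD(1)[OF F]
  note EF = eigenprojection_unique[OF E F]
  have *: "{v \<in> F. d v = c u} = {u}" if u: "u \<in> E" for u
  proof -
    let ?A = "{v \<in> F. d v = c u}"
    have "{v \<in> E. c v = c u} = {u}" using u inj by (auto dest: inj_onD)
    then have sum: "u = \<Sum>?A" using EF[of "c u"] by simp
    have prim: "primitive_idempotent J u" using jordan_frameD(3)[OF frE] u by simp
    have "v = u" if v: "v \<in> ?A" for v
    proof -
      have "J v u = v" using J_frame_subset_sum[OF frF, of v ?A] v sum by simp
      then have "J (u - v) (u - v) = u - v"
        using jordan_frameD(4)[OF frF, of v] jordan_frameD(4)[OF frE, of u] v u
        by (intro J_idempotent_diff) (auto simp: commute)
      then show ?thesis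
        using primitive_idempotent_splitD[OF prim, of v] jordan_frameD(4,5)[OF frF, of v] v by simp
    qed
    moreover have "?A \<noteq> {}" using sum jordan_frameD(5)[OF frE u] by (metis sum.empty)
    ultimately show ?thesis by blast
  qed
  have "v \<in> E" if v: "v \<in> F" for v
  proof (cases "d v \<in> c ` E")
    case True
    then obtain u where "u \<in> E" "d v = c u" by blast
    then have "v \<in> {u}" using *[of u] v by auto
    then show ?thesis using \<open>u \<in> E\<close> by simp
  next
    case False
    then have "{u \<in> E. c u = d v} = {}" by (auto simp: image_iff)
    then have "\<Sum>{w \<in> F. d w = d v} = 0" using EF[of "d v"] by (metis sum.empty)
    then have "v = 0" using J_frame_subset_sum[OF frF v, of "{w \<in> F. d w = d v}"] v by simp
    then show ?thesis using jordan_frameD(5)[OF frF v] by simp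
  qed
  then show "F = E" using * by blast
  show "u \<in> E \<Longrightarrow> d u = c u" using *[of u] by blast
qed

lemma sorted_wrt_ge_unique:
  assumes "sorted_wrt (\<ge>) xs" "sorted_wrt (\<ge>) ys" "mset xs = mset (ys :: real list)"
  shows "xs = ys"
proof -
  have "sorted (rev xs)" "sorted (rev ys)"
    using assms(1,2) by (simp_all add: sorted_wrt_rev)
  then have "rev xs = rev ys" using assms(3) by (metis mset_rev properties_for_sort)
  then show ?thesis by simp
qed

text \<open>Uniqueness of the multiset is a hypothesis, to be met first for injective coefficients
  and only later in general.\<close>

lemma eigenvalues_eqI:
  assumes E: "spectral_decomposition J e x E c"
    and uniq: "\<And>F d. spectral_decomposition J e x F d \<Longrightarrow>
      image_mset d (mset_set F) = image_mset c (mset_set E)"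
  shows "sorted_wrt (\<ge>) (eigenvalues J e x)" "mset (eigenvalues J e x) = image_mset c (mset_set E)"
proof -
  let ?P = "\<lambda>xs. sorted_wrt (\<ge>) xs \<and>
     (\<exists>E c. spectral_decomposition J e x E c \<and> mset xs = image_mset c (mset_set E))"
  let ?xs = "rev (sorted_list_of_multiset (image_mset c (mset_set E)))"
  have "mset ?xs = image_mset c (mset_set E)" "sorted_wrt (\<ge>) ?xs"
    by (simp_all add: sorted_wrt_rev)
  then have "?P ?xs" using E by blast
  moreover have "ys = ?xs" if "?P ys" for ys
    using that uniq \<open>?P ?xs\<close> sorted_wrt_ge_unique by metis
  ultimately have "?P (eigenvalues J e x)" unfolding eigenvalues_def by (rule theI)
  then show "sorted_wrt (\<ge>) (eigenvalues J e x)"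
    "mset (eigenvalues J e x) = image_mset c (mset_set E)" using uniq by metis+
qed

end

context trace_euclidean_jordan_algebra
begin

lemma inner_unit_inj:
  assumes E: "jordan_frame J e E" and inj: "inj_on c E"
  shows "(\<Sum>u\<in>E. c u *\<^sub>R u) \<bullet> e = (\<Sum>u\<in>E. c u)"
proof -
  let ?x = "\<Sum>u\<in>E. c u *\<^sub>R u"
  have sp: "spectral_decomposition J e ?x E c" using E by (simp add: spectral_decomposition_def)
  have "image_mset d (mset_set F) = image_mset c (mset_set E)"
    if "spectral_decomposition J e ?x F d" for F d
    using spectral_decomposition_unique_inj[OF sp that inj] jordan_frameD(1)[OF E]
    by (auto intro!: image_mset_cong)
  then have "mset (eigenvalues J e ?x) = image_mset c (mset_set E)"
    using eigenvalues_eqI(2)[OF sp] by blast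
  then have "jordan_trace J e ?x = (\<Sum>u\<in>E. c u)"
    unfolding jordan_trace_def by (metis sum_mset_sum_list sum_unfold_sum_mset)
  then show ?thesis using trace_inner[of ?x e] by simp
qed

text \<open>Two injective coefficient families that differ only at \<open>u\<close> isolate the
  trace of \<open>u\<close>.\<close>

lemma inner_unit_frame:
  assumes E: "jordan_frame J e E" and u: "u \<in> E"
  shows "u \<bullet> e = 1"
proof -
  note fin = jordan_frameD(1)[OF E]
  obtain f :: "'a \<Rightarrow> nat" where f: "inj_on f E" using finite_imp_inj_to_nat_seg[OF fin] by blast
  \<comment> \<open>The values of \<open>c\<close> are integers, so a shift by 1/2 at
    \<open>u\<close> cannot create a collision.\<close>
  define c where "c v = real (f v)" for v
  define d where "d v = c v + (if v = u then 1 / 2 else 0)" for v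
  have inj_c: "inj_on c E" using f by (auto simp: c_def inj_on_def)
  have half: "2 * d v = real (2 * f v + (if v = u then 1 else 0))" for v
    by (simp add: d_def c_def)
  have "f v = f w" if "d v = d w" for v w
  proof -
    have "2 * f v + (if v = u then 1 else 0) = 2 * f w + (if w = u then 1 else 0)"
      using half[of v] half[of w] that by linarith
    then show ?thesis by (simp split: if_splits; arith)
  qed
  then have inj_d: "inj_on d E" using f unfolding inj_on_def by blast
  have "(\<Sum>v\<in>E. d v *\<^sub>R v) = (\<Sum>v\<in>E. c v *\<^sub>R v) + (1 / 2) *\<^sub>R u"
    using fin u by (simp add: d_def scaleR_add_left sum.distrib if_distrib[of "\<lambda>r. r *\<^sub>R _"] cong: if_cong)
  moreover have "(\<Sum>v\<in>E. d v) = (\<Sum>v\<in>E. c v) + 1 / 2"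
    using fin u by (simp add: d_def sum.distrib)
  ultimately show ?thesis
    using inner_unit_inj[OF E inj_c] inner_unit_inj[OF E inj_d] by (simp add: inner_simps)
qed

lemma inner_frame_subset_sum:
  assumes "jordan_frame J e E" "A \<subseteq> E"
  shows "\<Sum>A \<bullet> e = card A"
  using assms inner_unit_frame by (auto simp: inner_sum_left subset_iff)

text \<open>Every frame has e \<bullet> e elements.\<close>

lemma jordan_rank_eq_card:
  assumes "jordan_frame J e E"
  shows "jordan_rank J e = card E"
proof -
  have "real (card F) = e \<bullet> e" if "jordan_frame J e F" for F
    using inner_frame_subset_sum[OF that, of F] jordan_frameD(2)[OF that] by simp
  then show ?thesis
    unfolding jordan_rank_def using assms by (intro the_equality) (auto, metis of_nat_eq_iff)
qed

text \<open>The multiplicity of an eigenvalue is the trace of its eigenprojection, hence the same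
  for every decomposition.\<close>

lemma eigenvalues_spectral_decomposition:
  assumes E: "spectral_decomposition J e x E c"
  shows "sorted_wrt (\<ge>) (eigenvalues J e x)" "mset (eigenvalues J e x) = image_mset c (mset_set E)"
proof -
  have count: "real (count (image_mset c (mset_set E)) t) = \<Sum>{u \<in> E. c u = t} \<bullet> e"
    if "spectral_decomposition J e x E c" for E c t
  proof -
    note fr = spectral_decompositionD(1)[OF that]
    have "c -` {t} \<inter> E = {u \<in> E. c u = t}" by auto
    then show ?thesis
      using inner_frame_subset_sum[OF fr, of "{u \<in> E. c u = t}"] jordan_frameD(1)[OF fr]
      by (simp add: count_image_mset)
  qed
  have "image_mset d (mset_set F) = image_mset c (mset_set E)"
    if F: "spectral_decomposition J e x F d" for F d
    using count[OF E] count[OF F] eigenprojection_unique[OF E F]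
    by (intro multiset_eqI) (metis of_nat_eq_iff)
  then show "sorted_wrt (\<ge>) (eigenvalues J e x)"
    "mset (eigenvalues J e x) = image_mset c (mset_set E)"
    using eigenvalues_eqI[OF E] by blast+
qed

lemma spectral_enumeration:
  assumes E: "spectral_decomposition J e x E c"
  obtains us where "distinct us" "set us = E" "eigenvalues J e x = map c us"
proof -
  have fin: "finite E" using spectral_decompositionD(1)[OF E] jordan_frameD(1) by blast
  then obtain vs where vs: "distinct vs" "set vs = E" using finite_distinct_list by blast
  then have "mset (eigenvalues J e x) = mset (map c vs)"
    using eigenvalues_spectral_decomposition(2)[OF E] by (metis mset_map mset_set_set)
  define us where "us = rev (sort_key c vs)"
  have "sorted_wrt (\<ge>) (map c us)" unfolding us_def
    by (simp add: sorted_wrt_rev flip: rev_map)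
  moreover have "mset (map c us) = mset (map c vs)" unfolding us_def by simp
  ultimately have "eigenvalues J e x = map c us"
    using sorted_wrt_ge_unique eigenvalues_spectral_decomposition(1)[OF E]
      \<open>mset (eigenvalues J e x) = mset (map c vs)\<close> by metis
  moreover have "distinct us" "set us = E" using vs by (auto simp: us_def)
  ultimately show ?thesis using that by blast
qed

end

section \<open>The quadratic representation\<close>

text \<open>Testing against a vector turns identities with scalar coefficients into real ones that
  simplification can settle.\<close>

lemma vector_eqI_inner: "(\<And>w. x \<bullet> w = y \<bullet> w) \<Longrightarrow> x = (y :: 'a::real_inner)"
  using vector_eq_rdot by blast

context euclidean_jordan_algebra
begin

lemma inner_eq_J_unit: "x \<bullet> y = J x y \<bullet> e"
  using inner_assoc[of x y e] by (simp add: inner_commute)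

lemma linear_quadratic_rep: "linear (quadratic_rep J a)"
  by (rule linearI) (simp_all add: quadratic_rep_def J_simps algebra_simps)

lemma quadratic_rep_selfadjoint: "quadratic_rep J a x \<bullet> y = x \<bullet> quadratic_rep J a y"
  by (simp add: quadratic_rep_def inner_simps inner_assoc)

lemma quadratic_rep_unit: "quadratic_rep J a e = J a a"
  by (simp add: quadratic_rep_def scaleR_2)

lemma Peirce_decomposition:
  assumes p: "J p p = p"
  obtains a1 v z where "a = a1 + v + z" "J p a1 = a1" "J p v = (1/2) *\<^sub>R v" "J p z = 0"
proof -
  define L M where "L = J p a" and "M = J p L"
  have K: "2 *\<^sub>R J p M = 3 *\<^sub>R M - L"
    using Peirce_polynomial[OF p, of a] by (simp add: L_def M_def algebra_simps)
  \<comment> \<open>These are the Lagrange polynomials 2 t^2 - t, 4 (t - t^2) and 1 - 3 t + 2 t^2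
    for the nodes 1, 1/2, 0, evaluated at \<open>J p\<close> and applied to
    \<open>a\<close>.\<close>
  define a1 v z where "a1 = 2 *\<^sub>R M - L" and "v = 4 *\<^sub>R (L - M)" and "z = a - 3 *\<^sub>R L + 2 *\<^sub>R M"
  have "J p a1 = 2 *\<^sub>R J p M - M" by (simp add: a1_def J_simps flip: M_def)
  also have "\<dots> = a1" unfolding K a1_def by (rule vector_eqI_inner) (simp add: inner_simps)
  finally have 1: "J p a1 = a1" .
  have "J p v = 4 *\<^sub>R M - 2 *\<^sub>R (2 *\<^sub>R J p M)" by (simp add: v_def J_simps scaleR_right_diff_distrib flip: M_def)
  also have "\<dots> = 2 *\<^sub>R L - 2 *\<^sub>R M"
    unfolding K by (rule vector_eqI_inner) (simp add: inner_simps algebra_simps)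
  also have "\<dots> = (1/2) *\<^sub>R v" by (simp add: v_def scaleR_right_diff_distrib)
  finally have 2: "J p v = (1/2) *\<^sub>R v" .
  have "J p z = L - 3 *\<^sub>R M + 2 *\<^sub>R J p M" by (simp add: z_def J_simps flip: L_def M_def)
  then have 3: "J p z = 0" unfolding K by simp
  have "a = a1 + v + z"
    by (rule vector_eqI_inner) (simp add: a1_def v_def z_def inner_simps algebra_simps)
  then show ?thesis using 1 2 3 that by blast
qed

lemma quadratic_rep_primitive:
  assumes p: "primitive_idempotent J p"
  obtains \<mu> where "\<mu> \<ge> 0"
    "J (quadratic_rep J a p) (quadratic_rep J a p) = \<mu> *\<^sub>R quadratic_rep J a p"
proof -
  note pp = primitive_idempotentD[OF p]
  obtain a1 v z where a: "a = a1 + v + z" and a1: "J p a1 = a1"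
    and v: "J p v = (1/2) *\<^sub>R v" and z: "J p z = 0"
    by (rule Peirce_decomposition[OF pp(1)])
  obtain \<alpha> where \<alpha>: "a1 = \<alpha> *\<^sub>R p" using primitive_Peirce_1[OF p a1] by blast
  define u where "u = J v v"
  obtain s where s: "J p u = s *\<^sub>R p"
    using primitive_Peirce_1[OF p Peirce_half_half[OF pp(1) v]] u_def by blast
  have "s * (p \<bullet> p) = J p u \<bullet> p" using s by simp
  also have "\<dots> = u \<bullet> p" using inner_assoc[of p u p] pp(1) by simp
  also have "\<dots> = v \<bullet> J v p" unfolding u_def by (rule inner_assoc)
  also have "\<dots> = (v \<bullet> v) / 2" using v by (simp add: commute[of v p])
  finally have "s * (p \<bullet> p) \<ge> 0" using inner_ge_zero[of v] by linarith
  moreover have "p \<bullet> p > 0" using pp(2) by simp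
  ultimately have s0: "s \<ge> 0" using zero_le_mult_iff[of s "p \<bullet> p"] by linarith
  \<comment> \<open>The Jordan identity at \<open>v\<close>, applied to \<open>p\<close> and then to
    \<open>v\<close>, yields \<open>J v u = s *\<^sub>R v\<close> and
    \<open>J u u = s *\<^sub>R u\<close>.\<close>
  have "s *\<^sub>R J v p = J u (J v p)"
    using jordan_identity[of v p] s by (simp add: u_def[symmetric] J_simps commute[of u p])
  then have half: "(s / 2) *\<^sub>R v = (1 / 2) *\<^sub>R J v u"
    using v by (simp add: commute[of v p] J_simps commute[of u v])
  have vu: "J v u = s *\<^sub>R v" using arg_cong[OF half, of "\<lambda>y. 2 *\<^sub>R y"] by simp
  then have uu: "J u u = s *\<^sub>R u"
    using jordan_identity[of v v] by (simp add: J_simps commute[of u v] flip: u_def)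
  have zp: "J z p = 0" and vp: "J v p = (1/2) *\<^sub>R v" and up: "J u p = s *\<^sub>R p" and uv: "J u v = s *\<^sub>R v"
    using z v s vu commute[of p z] commute[of p v] commute[of p u] commute[of v u] by simp_all
  have pz: "J (J z v) p = (1/2) *\<^sub>R J z v" "J (J z z) p = 0"
    using J_commute_idempotent[OF pp(1), of z v] J_commute_idempotent[OF pp(1), of z z] z v
    by (simp_all add: J_simps commute[of "J z v" p] commute[of "J z z" p])
  have ap: "J a p = \<alpha> *\<^sub>R p + (1/2) *\<^sub>R v" by (simp add: a \<alpha> J_simps pp zp vp)
  have "2 *\<^sub>R J a (J a p) = (2 * \<alpha>\<^sup>2) *\<^sub>R p + (3 / 2 * \<alpha>) *\<^sub>R v + u + J z v"
    unfolding ap by (rule vector_eqI_inner)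
      (simp add: a \<alpha> J_simps pp v vp zp inner_simps power2_eq_square algebra_simps flip: u_def)
  moreover have "J a a = \<alpha>\<^sup>2 *\<^sub>R p + \<alpha> *\<^sub>R v + u + 2 *\<^sub>R J z v + J z z"
    by - (rule vector_eqI_inner, simp add: a \<alpha> J_simps pp v vp zp z inner_simps power2_eq_square commute[of v z] algebra_simps flip: u_def)
  then have "J (J a a) p = (\<alpha>\<^sup>2 + s) *\<^sub>R p + (\<alpha> / 2) *\<^sub>R v + J z v"
    by - (rule vector_eqI_inner, simp add: J_simps pp vp up zp pz inner_simps algebra_simps)
  ultimately have x: "quadratic_rep J a p = (\<alpha>\<^sup>2 - s) *\<^sub>R p + \<alpha> *\<^sub>R v + u"
    by - (rule vector_eqI_inner, simp add: quadratic_rep_def inner_simps algebra_simps)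
  \<comment> \<open>For \<beta> = \<alpha>^2 - s the factor \<beta> + 2 s equals \<alpha>^2 + s, and
    all three coefficients scale alike.\<close>
  have square: "J (\<beta> *\<^sub>R p + \<alpha> *\<^sub>R v + u) (\<beta> *\<^sub>R p + \<alpha> *\<^sub>R v + u)
      = (\<beta> * (\<beta> + 2 * s)) *\<^sub>R p + (\<alpha> * (\<beta> + 2 * s)) *\<^sub>R v + (\<alpha>\<^sup>2 + s) *\<^sub>R u" for \<beta>
    by (rule vector_eqI_inner)
      (simp add: J_simps pp v vp s up uv vu uu inner_simps power2_eq_square algebra_simps flip: u_def)
  have "J (quadratic_rep J a p) (quadratic_rep J a p) = (\<alpha>\<^sup>2 + s) *\<^sub>R quadratic_rep J a p"
    unfolding x square by (rule vector_eqI_inner) (simp add: inner_simps algebra_simps)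
  then show ?thesis using that[of "\<alpha>\<^sup>2 + s"] s0 by simp
qed

text \<open>The image of \<open>p\<close> is either 0 or a positive multiple of an
  idempotent.\<close>

lemma quadratic_rep_primitive_inner_nonneg:
  assumes p: "primitive_idempotent J p" and q: "J q q = q"
  shows "quadratic_rep J a p \<bullet> q \<ge> 0"
proof -
  define x where "x = quadratic_rep J a p"
  obtain \<mu> where \<mu>: "\<mu> \<ge> 0" "J x x = \<mu> *\<^sub>R x" unfolding x_def by (rule quadratic_rep_primitive[OF p])
  show ?thesis
  proof (cases "\<mu> = 0")
    case True
    then have "x = 0" using \<mu> inner_eq_J_unit[of x x] by simp
    then show ?thesis by (simp flip: x_def)
  next
    case False
    then have "J (x /\<^sub>R \<mu>) (x /\<^sub>R \<mu>) = x /\<^sub>R \<mu>" using \<mu> by (simp add: J_simps)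
    then have "(x /\<^sub>R \<mu>) \<bullet> q \<ge> 0" using q by (rule idempotents_inner_nonneg)
    then show ?thesis using \<mu> False by (simp add: zero_le_mult_iff flip: x_def)
  qed
qed

lemma quadratic_rep_inner_nonneg:
  assumes c: "J c c = c" and d: "J d d = d"
  shows "quadratic_rep J a c \<bullet> d \<ge> 0"
proof -
  obtain E where E: "jordan_frame J c E" using jordan_frame_exists[OF c] by blast
  have "quadratic_rep J a c = (\<Sum>u\<in>E. quadratic_rep J a u)"
    using linear_sum[OF linear_quadratic_rep, of a "\<lambda>u. u" E] jordan_frameD(2)[OF E] by simp
  then show ?thesis
    using quadratic_rep_primitive_inner_nonneg[OF jordan_frameD(3)[OF E] d]
    by (simp add: inner_sum_left sum_nonneg)
qed

end

text \<open>Bathtub principle: comparing \<open>g\<close> with the indicator of the first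
  \<open>k\<close> indices, weight moves only towards larger values of \<open>l\<close>.\<close>

lemma sum_weighted_le_sum_top:
  fixes l g :: "nat \<Rightarrow> real"
  assumes dec: "\<And>i j. i \<le> j \<Longrightarrow> j < n \<Longrightarrow> l j \<le> l i"
    and g: "\<And>i. i < n \<Longrightarrow> 0 \<le> g i \<and> g i \<le> 1" and sum: "(\<Sum>i<n. g i) = real k" and "k \<le> n"
  shows "(\<Sum>i<n. l i * g i) \<le> (\<Sum>i<k. l i)"
proof -
  let ?h = "\<lambda>i. if i < k then 1 else 0 :: real"
  \<comment> \<open>The threshold is the k-th largest value. For k = 0 it is \<open>l 0\<close>,
    which still bounds every \<open>l i\<close> from above.\<close>
  let ?\<mu> = "l (k - 1)"
  have "(l i - ?\<mu>) * (g i - ?h i) \<le> 0" if "i < n" for i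
  proof (cases "i < k")
    case True
    then show ?thesis using dec[of i "k - 1"] g[OF that] \<open>k \<le> n\<close> by (simp add: mult_nonneg_nonpos)
  next
    case False
    then show ?thesis using dec[of "k - 1" i] g[OF that] that by (simp add: mult_nonpos_nonneg)
  qed
  then have "(\<Sum>i<n. (l i - ?\<mu>) * (g i - ?h i)) \<le> 0" by (intro sum_nonpos) simp
  also have "(\<Sum>i<n. (l i - ?\<mu>) * (g i - ?h i)) =
      (\<Sum>i<n. l i * g i) - (\<Sum>i<n. l i * ?h i) - ?\<mu> * ((\<Sum>i<n. g i) - (\<Sum>i<n. ?h i))"
    by (simp add: algebra_simps sum.distrib sum_subtractf sum_distrib_left sum_distrib_right)
  also have "(\<Sum>i<n. l i * ?h i) = (\<Sum>i<k. l i)"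
    using \<open>k \<le> n\<close> by (intro sum.mono_neutral_cong_right) auto
  also have "(\<Sum>i<n. ?h i) = (\<Sum>i<k. 1)"
    using \<open>k \<le> n\<close> by (intro sum.mono_neutral_cong_right) auto
  finally show ?thesis using sum by simp
qed

text \<open>Summation by parts in inductive form, carrying the boundary term
  \<open>\<beta> m * D (Suc m)\<close> as a lower bound.\<close>

lemma sum_mult_mono_partial_sums:
  fixes \<beta> g h :: "nat \<Rightarrow> real"
  assumes dec: "\<And>i j. i \<le> j \<Longrightarrow> j < n \<Longrightarrow> \<beta> j \<le> \<beta> i" and nonneg: "\<And>i. i < n \<Longrightarrow> 0 \<le> \<beta> i"
    and le: "\<And>j. j \<le> n \<Longrightarrow> (\<Sum>i<j. g i) \<le> (\<Sum>i<j. h i)"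
  shows "(\<Sum>i<n. \<beta> i * g i) \<le> (\<Sum>i<n. \<beta> i * h i)"
proof -
  define D where "D j = (\<Sum>i<j. h i - g i)" for j
  have D: "0 \<le> D j" if "j \<le> n" for j using le[OF that] by (simp add: D_def sum_subtractf)
  have *: "\<beta> m * D (Suc m) \<le> (\<Sum>i<Suc m. \<beta> i * (h i - g i))" if "m < n" for m
    using that
  proof (induction m)
    case 0
    then show ?case by (simp add: D_def)
  next
    case (Suc m)
    have "\<beta> (Suc m) * D (Suc m) \<le> \<beta> m * D (Suc m)"
      using Suc.prems dec[of m "Suc m"] D[of "Suc m"] by (intro mult_right_mono) auto
    moreover have "D (Suc (Suc m)) = D (Suc m) + (h (Suc m) - g (Suc m))" by (simp add: D_def)
    then have "\<beta> (Suc m) * D (Suc (Suc m)) = \<beta> (Suc m) * D (Suc m) + \<beta> (Suc m) * (h (Suc m) - g (Suc m))"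
      by (simp add: distrib_left)
    ultimately show ?case using Suc by simp
  qed
  have "0 \<le> (\<Sum>i<n. \<beta> i * (h i - g i))"
  proof (cases n)
    case (Suc m)
    then have "0 \<le> \<beta> m * D (Suc m)" using nonneg D by simp
    then show ?thesis using *[of m] Suc by simp
  qed simp
  then show ?thesis by (simp add: right_diff_distrib sum_subtractf)
qed

lemma sum_list_take_nth:
  "k \<le> length xs \<Longrightarrow> sum_list (take k xs) = (\<Sum>i<k. xs ! i)"
  by (simp add: sum_list_sum_nth atLeast0LessThan)

section \<open>Weak majorization\<close>

context trace_euclidean_jordan_algebra
begin

lemma eigenvalues_enumeration:
  obtains us where "distinct us" "jordan_frame J e (set us)" "length us = jordan_rank J e"
    "length (eigenvalues J e x) = jordan_rank J e"
    "x = (\<Sum>i<jordan_rank J e. eigenvalues J e x ! i *\<^sub>R us ! i)"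
proof -
  obtain E c where E: "spectral_decomposition J e x E c" using spectral_decomposition_exists by blast
  obtain us where us: "distinct us" "set us = E" "eigenvalues J e x = map c us"
    by (rule spectral_enumeration[OF E])
  note fr = spectral_decompositionD(1)[OF E]
  have len: "length us = jordan_rank J e" using jordan_rank_eq_card[OF fr] us distinct_card by fastforce
  have "bij_betw ((!) us) {..<length us} E" using bij_betw_nth[OF us(1)] us(2) by simp
  then have "x = (\<Sum>i<length us. c (us ! i) *\<^sub>R us ! i)"
    using spectral_decompositionD(2)[OF E] sum.reindex_bij_betw[of "(!) us" _ E "\<lambda>u. c u *\<^sub>R u"] by simp
  then show ?thesis using that[of us] us len fr by simp
qed

lemma eigenvalues_nth_mono:
  "i \<le> j \<Longrightarrow> j < jordan_rank J e \<Longrightarrow> eigenvalues J e x ! j \<le> eigenvalues J e x ! i"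
  using eigenvalues_spectral_decomposition(1) spectral_decomposition_exists[of x]
    eigenvalues_enumeration[of x] sorted_wrt_nth_less[of "(\<ge>)" "eigenvalues J e x" i j]
  by (metis le_neq_implies_less order_refl)

lemma frame_subset_sum_complement:
  assumes "jordan_frame J e E" "A \<subseteq> E"
  shows "J (e - \<Sum>A) (e - \<Sum>A) = e - \<Sum>A"
  using frame_subset_sum_idempotent[OF assms] unit by (intro J_idempotent_diff) auto

text \<open>The weights \<open>us ! i \<bullet> \<Sum>A\<close> lie in [0, 1], since
  \<open>\<Sum>A\<close> and its complement are idempotents, and they add up to
  \<open>card A\<close>.\<close>

lemma Ky_Fan:
  assumes E: "jordan_frame J e E" and A: "A \<subseteq> E"
  shows "x \<bullet> \<Sum>A \<le> (\<Sum>i<card A. eigenvalues J e x ! i)"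
proof -
  let ?n = "jordan_rank J e"
  obtain us where us: "distinct us" "jordan_frame J e (set us)" "length us = ?n"
    and x: "x = (\<Sum>i<?n. eigenvalues J e x ! i *\<^sub>R us ! i)"
    by (rule eigenvalues_enumeration)
  have idem: "J (\<Sum>A) (\<Sum>A) = \<Sum>A" "J (e - \<Sum>A) (e - \<Sum>A) = e - \<Sum>A"
    using frame_subset_sum_idempotent frame_subset_sum_complement E A by blast+
  have g: "0 \<le> us ! i \<bullet> \<Sum>A \<and> us ! i \<bullet> \<Sum>A \<le> 1" if "i < ?n" for i
  proof -
    have i: "us ! i \<in> set us" using that us(3) by simp
    note id = jordan_frameD(4)[OF us(2) i]
    show ?thesis
      using idempotents_inner_nonneg[OF id idem(1)] idempotents_inner_nonneg[OF id idem(2)]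
        inner_unit_frame[OF us(2) i] by (simp add: inner_diff_right)
  qed
  have "(\<Sum>i<?n. us ! i) = e"
    using jordan_frameD(2)[OF us(2)] us sum.reindex_bij_betw[OF bij_betw_nth[OF us(1) refl refl], of "\<lambda>u. u"]
    by simp
  then have "(\<Sum>i<?n. us ! i \<bullet> \<Sum>A) = card A"
    using inner_frame_subset_sum[OF E A] by (simp add: inner_commute flip: inner_sum_left)
  moreover have "card A \<le> ?n"
    using A jordan_rank_eq_card[OF E] jordan_frameD(1)[OF E] by (simp add: card_mono)
  ultimately have "(\<Sum>i<?n. eigenvalues J e x ! i * (us ! i \<bullet> \<Sum>A)) \<le> (\<Sum>i<card A. eigenvalues J e x ! i)"
    using g eigenvalues_nth_mono by (intro sum_weighted_le_sum_top) auto
  moreover have "x \<bullet> \<Sum>A = (\<Sum>i<?n. eigenvalues J e x ! i * (us ! i \<bullet> \<Sum>A))"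
    by (subst x) (simp add: inner_sum_left)
  ultimately show ?thesis by simp
qed

lemma quadratic_rep_subset_sums_inner_le:
  assumes E: "jordan_frame J e E" "A \<subseteq> E" and F: "jordan_frame J e F" "B \<subseteq> F"
  shows "quadratic_rep J a (\<Sum>A) \<bullet> \<Sum>B \<le> (\<Sum>i<min (card A) (card B). eigenvalues J e (J a a) ! i)"
proof -
  have le: "quadratic_rep J a (\<Sum>A) \<bullet> \<Sum>B \<le> (\<Sum>i<card B. eigenvalues J e (J a a) ! i)"
    if E: "jordan_frame J e E" "A \<subseteq> E" and F: "jordan_frame J e F" "B \<subseteq> F" for E A F B
  proof -
    have "0 \<le> quadratic_rep J a (e - \<Sum>A) \<bullet> \<Sum>B"
      using quadratic_rep_inner_nonneg frame_subset_sum_complement[OF E] frame_subset_sum_idempotent[OF F]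
      by blast
    then have "quadratic_rep J a (\<Sum>A) \<bullet> \<Sum>B \<le> J a a \<bullet> \<Sum>B"
      by (simp add: linear_diff[OF linear_quadratic_rep] quadratic_rep_unit inner_diff_left)
    then show ?thesis using Ky_Fan[OF F, of "J a a"] by simp
  qed
  show ?thesis
    using le[OF E F] le[OF F E] quadratic_rep_selfadjoint[of a "\<Sum>A" "\<Sum>B"]
    by (auto simp: min_def inner_commute)
qed

lemma quadratic_rep_inner_le:
  assumes nonneg: "\<And>i. i < jordan_rank J e \<Longrightarrow> 0 \<le> eigenvalues J e y ! i"
    and K: "jordan_frame J e K" "A \<subseteq> K"
  shows "quadratic_rep J a y \<bullet> \<Sum>A
    \<le> (\<Sum>i<card A. eigenvalues J e (J a a) ! i * eigenvalues J e y ! i)"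
proof -
  let ?n = "jordan_rank J e" and ?\<alpha> = "eigenvalues J e (J a a)" and ?\<beta> = "eigenvalues J e y"
  obtain us where us: "distinct us" "jordan_frame J e (set us)" "length us = ?n"
    and y: "y = (\<Sum>i<?n. ?\<beta> ! i *\<^sub>R us ! i)"
    by (rule eigenvalues_enumeration)
  let ?g = "\<lambda>i. quadratic_rep J a (us ! i) \<bullet> \<Sum>A"
  \<comment> \<open>Cutting the eigenvalues off at \<open>card A\<close> makes the partial sums of
    \<open>?h\<close> stop at the minimum of \<open>j\<close> and \<open>card A\<close>.\<close>
  let ?h = "\<lambda>i. if i < card A then ?\<alpha> ! i else 0"
  have partial: "(\<Sum>i<j. ?g i) \<le> (\<Sum>i<j. ?h i)" if j: "j \<le> ?n" for j
  proof -
    have "inj_on ((!) us) {..<j}" using us j by (auto simp: inj_on_def nth_eq_iff_index_eq)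
    then have B: "card ((!) us ` {..<j}) = j" "\<Sum>((!) us ` {..<j}) = (\<Sum>i<j. us ! i)"
      by (simp_all add: card_image sum.reindex)
    have sub: "(!) us ` {..<j} \<subseteq> set us" using us j by auto
    have "(\<Sum>i<j. ?g i) = quadratic_rep J a (\<Sum>i<j. us ! i) \<bullet> \<Sum>A"
      by (simp add: linear_sum[OF linear_quadratic_rep] inner_sum_left)
    also have "\<dots> \<le> (\<Sum>i<min j (card A). ?\<alpha> ! i)"
      using quadratic_rep_subset_sums_inner_le[OF us(2) sub K] B by simp
    also have "\<dots> = (\<Sum>i<j. ?h i)"
      by (intro sum.mono_neutral_cong_left) auto
    finally show ?thesis .
  qed
  have cA: "card A \<le> ?n"
    using K jordan_rank_eq_card[OF K(1)] jordan_frameD(1)[OF K(1)] by (simp add: card_mono)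
  have "quadratic_rep J a y \<bullet> \<Sum>A = (\<Sum>i<?n. ?\<beta> ! i * ?g i)"
    by (subst y) (simp add: linear_sum[OF linear_quadratic_rep] linear_scale[OF linear_quadratic_rep] inner_sum_left)
  also have "\<dots> \<le> (\<Sum>i<?n. ?\<beta> ! i * ?h i)"
    using eigenvalues_nth_mono nonneg partial by (intro sum_mult_mono_partial_sums)
  also have "\<dots> = (\<Sum>i<card A. ?\<alpha> ! i * ?\<beta> ! i)"
    using cA by (intro sum.mono_neutral_cong_right) auto
  finally show ?thesis .
qed

lemma eigenvalues_nonneg:
  assumes "spectral_decomposition J e x E c" "\<And>u. u \<in> E \<Longrightarrow> 0 \<le> c u" "t \<in> set (eigenvalues J e x)"
  shows "0 \<le> t"
proof -
  obtain us where "set us = E" "eigenvalues J e x = map c us"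
    by (rule spectral_enumeration[OF assms(1)])
  then show ?thesis using assms by auto
qed

lemma eigenvalues_square_nonneg:
  assumes "t \<in> set (eigenvalues J e (J a a))"
  shows "0 \<le> t"
proof -
  obtain E c where E: "spectral_decomposition J e a E c" using spectral_decomposition_exists by blast
  have "J a a = (\<Sum>u\<in>E. (c u)\<^sup>2 *\<^sub>R u)"
  proof -
    have "J a a = (\<Sum>u\<in>E. c u *\<^sub>R J a u)"
      by (subst (2) spectral_decompositionD(2)[OF E]) (simp add: J_sum_right J_simps)
    then show ?thesis
      using spectral_decompositionD(3)[OF E] by (simp add: power2_eq_square)
  qed
  then have "spectral_decomposition J e (J a a) E (\<lambda>u. (c u)\<^sup>2)"
    using spectral_decompositionD(1)[OF E] by (simp add: spectral_decomposition_def)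
  then show ?thesis using eigenvalues_nonneg assms by auto
qed

end

section \<open>Sublinear functions and decreasing lists\<close>

lemma sublinear_sum_le:
  assumes \<phi>: "sublinear \<phi>" and "finite F" "\<And>v. v \<in> F \<Longrightarrow> 0 \<le> m v"
  shows "\<phi> (\<Sum>v\<in>F. m v * d v) \<le> (\<Sum>v\<in>F. m v * \<phi> (d v))"
  using assms(2,3)
proof (induction F rule: finite_induct)
  case empty
  have "\<phi> (0 * 0) = 0 * \<phi> 0" using \<phi> unfolding sublinear_def by blast
  then show ?case by simp
next
  case (insert v F)
  have "\<phi> (m v * d v + (\<Sum>v\<in>F. m v * d v)) \<le> \<phi> (m v * d v) + \<phi> (\<Sum>v\<in>F. m v * d v)"
    and "\<phi> (m v * d v) = m v * \<phi> (d v)"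
    using \<phi> insert.prems unfolding sublinear_def by blast+
  then show ?case using insert by force
qed

lemma decreasing_rearrangement_sorted:
  assumes "sorted_wrt (\<ge>) p"
  shows "decreasing_rearrangement p = p"
proof -
  have "sort p = rev p"
    using assms by (intro properties_for_sort) (simp_all add: sorted_wrt_rev)
  then show ?thesis by (simp add: decreasing_rearrangement_def)
qed

lemma sorted_componentwise_product:
  assumes "sorted_wrt (\<ge>) p" "sorted_wrt (\<ge>) q"
    and "\<And>t. t \<in> set p \<Longrightarrow> 0 \<le> t" "\<And>t. t \<in> set q \<Longrightarrow> 0 \<le> t"
  shows "sorted_wrt (\<ge>) (componentwise_product p q)"
  using assms unfolding componentwise_product_def sorted_wrt_iff_nth_less
  by (auto intro!: mult_mono)

section \<open>The majorization for nonnegative sublinear functions\<close>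

context trace_euclidean_jordan_algebra
begin

lemma lowner_map_quadratic_rep_weakly_majorized:
  assumes nonneg: "\<And>t. 0 \<le> \<phi> t" and sub: "sublinear \<phi>"
  shows "weakly_majorized (jordan_rank J e)
    (eigenvalues J e (lowner_map J e \<phi> (quadratic_rep J a b)))
    (componentwise_product (eigenvalues J e (J a a)) (eigenvalues J e (lowner_map J e \<phi> b)))"
proof -
  let ?n = "jordan_rank J e" and ?z = "quadratic_rep J a b"
  let ?p = "eigenvalues J e (lowner_map J e \<phi> ?z)"
  let ?\<alpha> = "eigenvalues J e (J a a)" and ?\<beta> = "eigenvalues J e (lowner_map J e \<phi> b)"
  obtain E c where E: "spectral_decomposition J e ?z E c" using spectral_decomposition_exists by blast
  obtain F d where F: "spectral_decomposition J e b F d" using spectral_decomposition_exists by blast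
  note frE = spectral_decompositionD(1)[OF E] and frF = spectral_decompositionD(1)[OF F]
  have E': "spectral_decomposition J e (lowner_map J e \<phi> ?z) E (\<lambda>u. \<phi> (c u))"
    using frE lowner_map_eq[OF E] by (simp add: spectral_decomposition_def)
  have F': "spectral_decomposition J e (lowner_map J e \<phi> b) F (\<lambda>v. \<phi> (d v))"
    using frF lowner_map_eq[OF F] by (simp add: spectral_decomposition_def)
  obtain us where us: "distinct us" "set us = E" "?p = map (\<lambda>u. \<phi> (c u)) us"
    by (rule spectral_enumeration[OF E'])
  have len: "length (eigenvalues J e x) = ?n" for x by (rule eigenvalues_enumeration)
  have sorted: "sorted_wrt (\<ge>) (eigenvalues J e x)" for x
    using eigenvalues_spectral_decomposition(1) spectral_decomposition_exists by blast
  have \<beta>: "0 \<le> t" if "t \<in> set ?\<beta>" for t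
    using eigenvalues_nonneg[OF F'] nonneg that by blast
  have bound: "\<phi> (c u) \<le> quadratic_rep J a (lowner_map J e \<phi> b) \<bullet> u" if u: "u \<in> E" for u
  proof -
    have "c u = ?z \<bullet> u"
      using inner_eq_J_unit[of ?z u] spectral_decompositionD(3)[OF E u] inner_unit_frame[OF frE u] by simp
    also have "\<dots> = (\<Sum>v\<in>F. (quadratic_rep J a v \<bullet> u) * d v)"
      by (subst spectral_decompositionD(2)[OF F])
        (simp add: linear_sum[OF linear_quadratic_rep] linear_scale[OF linear_quadratic_rep] inner_sum_left mult.commute)
    finally have "\<phi> (c u) \<le> (\<Sum>v\<in>F. (quadratic_rep J a v \<bullet> u) * \<phi> (d v))"
      using sublinear_sum_le[OF sub jordan_frameD(1)[OF frF], of "\<lambda>v. quadratic_rep J a v \<bullet> u" d]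
        quadratic_rep_inner_nonneg[OF jordan_frameD(4)[OF frF] jordan_frameD(4)[OF frE u]] by simp
    also have "\<dots> = quadratic_rep J a (lowner_map J e \<phi> b) \<bullet> u"
      by (simp add: lowner_map_eq[OF F] linear_sum[OF linear_quadratic_rep]
          linear_scale[OF linear_quadratic_rep] inner_sum_left mult.commute)
    finally show ?thesis .
  qed
  have "sum_list (take k ?p) \<le> sum_list (take k (componentwise_product ?\<alpha> ?\<beta>))" if k: "k \<le> ?n" for k
  proof -
    \<comment> \<open>\<open>A\<close> collects the frame elements that carry the \<open>k\<close>
      largest eigenvalues of the left-hand element.\<close>
    define A where "A = set (take k us)"
    have A: "A \<subseteq> E" using us(2) set_take_subset A_def by fast
    have "length us = ?n" using len[of "lowner_map J e \<phi> ?z"] us(3) by simp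
    then have cA: "card A = k" using us(1) k by (simp add: A_def distinct_card)
    have "sum_list (take k ?p) = (\<Sum>u\<in>A. \<phi> (c u))"
      unfolding A_def us(3) take_map using us(1) by (simp add: sum_list_distinct_conv_sum_set)
    also have "\<dots> \<le> (\<Sum>u\<in>A. quadratic_rep J a (lowner_map J e \<phi> b) \<bullet> u)"
      using bound A by (intro sum_mono) auto
    also have "\<dots> = quadratic_rep J a (lowner_map J e \<phi> b) \<bullet> \<Sum>A" by (simp add: inner_sum_right)
    also have "\<dots> \<le> (\<Sum>i<k. ?\<alpha> ! i * ?\<beta> ! i)"
      using quadratic_rep_inner_le[of "lowner_map J e \<phi> b" E A a] frE A cA \<beta> len by simp
    also have "\<dots> = sum_list (take k (componentwise_product ?\<alpha> ?\<beta>))"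
      using k len by (simp add: sum_list_take_nth componentwise_product_def)
    finally show ?thesis .
  qed
  \<comment> \<open>Both lists are already decreasing, the product because its factors are
    nonnegative, so the rearrangements disappear.\<close>
  then show ?thesis
    unfolding weakly_majorized_def
    using len sorted \<beta> eigenvalues_square_nonneg
    by (simp add: decreasing_rearrangement_sorted sorted_componentwise_product)
      (simp add: componentwise_product_def)
qed

end

theorem theorem3p5:
  fixes J :: "'a::euclidean_space \<Rightarrow> 'a \<Rightarrow> 'a" and e :: 'a and n :: nat
  assumes "trace_euclidean_jordan_algebra J e"
    and "jordan_rank J e = n"
  shows "(\<forall>\<phi>. (\<forall>t. 0 \<le> \<phi> t) \<and> sublinear \<phi> \<longrightarrow>
      (\<forall>a b. weakly_majorized n
        (eigenvalues J e (lowner_map J e \<phi> (quadratic_rep J a b)))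
        (componentwise_product (eigenvalues J e (J a a))
          (eigenvalues J e (lowner_map J e \<phi> b))))) \<and>
    (\<forall>a b. weakly_majorized n
      (eigenvalues J e (jordan_abs J e (quadratic_rep J a b)))
      (componentwise_product (eigenvalues J e (J a a))
        (eigenvalues J e (jordan_abs J e b))))"
proof -
  interpret trace_euclidean_jordan_algebra J e by fact
  have "sublinear (\<lambda>t. \<bar>t\<bar>)" by (simp add: sublinear_def abs_mult abs_triangle_ineq)
  then show ?thesis
    using lowner_map_quadratic_rep_weakly_majorized assms(2) unfolding jordan_abs_def by auto
qed

end
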